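(* Let $n\ge 1$, $\alpha^2,\nu,t_0>0$, $\boldsymbol\beta\in\mathbb{R}^n$. Let $f\in L^2(\mathbb{R}^n)$ be the unknown source and let $u$, with $u(\cdot,t)\in L^2(\mathbb{R}^n)$, satisfy $$u_t(\mathbf{x},t)=\alpha^2\Delta u(\mathbf{x},t)-\boldsymbol\beta\cdot\nabla u(\mathbf{x},t)-\nu u(\mathbf{x},t)+f(\mathbf{x}),\quad \mathbf{x}\in\mathbb{R}^n,\ t>0,\qquad u(\mathbf{x},0)=0,\quad \mathbf{x}\in\mathbb{R}^n.$$ Consider the problem of identifying $f$ from noisy data $y_\delta\in L^2(\mathbb{R}^n)$ of $y=u(\cdot,t_0)$, with $\|y-y_\delta\|_{L^2(\mathbb{R}^n)}\le\delta$, $0<\delta\le\delta_M$. For $\mu>0$ let $R_\mu:L^2(\mathbb{R}^n)\to L^2(\mathbb{R}^n)$ be defined by $$R_\mu\hat y(\boldsymbol\xi)=\frac{\Lambda(\boldsymbol\xi)}{1+\mu^2\|\boldsymbol\xi\|^2}\,\hat y(\boldsymbol\xi),\qquad \Lambda(\boldsymbol\xi)=\frac{z(\boldsymbol\xi)}{1-e^{-z(\boldsymbol\xi)t_0}},\qquad z(\boldsymbol\xi)=\alpha^2\|\boldsymbol\xi\|^2+i\,\boldsymbol\beta\cdot\boldsymbol\xi+\nu .$$ Then for every $y=u(\cdot,t_0)$ there exists an a-priori parameter choice rule $\mu=\mu(\delta)>0$ such that the pair $(R_\mu,\mu)$ is a convergent regularization method for solving this identification problem, that is, for solving $\hat f=\Lambda\hat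 y$ for $\hat f$.
   Context: The Fourier transform is $\hat g(\boldsymbol\xi)=(2\pi)^{-n/2}\int_{\mathbb{R}^n}e^{-i\boldsymbol\xi\cdot\mathbf{x}}g(\mathbf{x})\,d\mathbf{x}$, extended to a unitary operator on $L^2(\mathbb{R}^n)$. The evolution equation is understood in frequency space: $\hat u_t(\boldsymbol\xi,t)=-z(\boldsymbol\xi)\hat u(\boldsymbol\xi,t)+\hat f(\boldsymbol\xi)$, $\hat u(\boldsymbol\xi,0)=0$, so that $\hat u(\boldsymbol\xi,t)=\frac{1-e^{-z(\boldsymbol\xi)t}}{z(\boldsymbol\xi)}\hat f(\boldsymbol\xi)$, and for $y=u(\cdot,t_0)$ one has $\hat f=\Lambda\hat y$. The number $\delta_M>0$ is a fixed maximal noise level. $\|\cdot\|$ on $\mathbb{R}^n$ is the Euclidean norm. Convergent regularization method: for a given exact datum $y$ with $\Lambda\hat y\in L^2(\mathbb{R}^n)$, an a-priori parameter choice rule is a function $\delta\mapsto\mu(\delta)\in(0,\infty)$ depending on the noise level $\delta$ but not on the noisy datum $y_\delta$. The pair $(R_\mu,\mu)$ is a convergent regularization method (at $y$) if every $R_\mu$, $\mu>0$, is a bounded linear operator on $L^2(\mathbb{R}^n)$, $\mu(\delta)\to0$ as $\delta\to0^+$, and $$\lim_{\delta\to0^+}\ \sup\Big\{\|R_{\mu(\delta)}\hat y_\delta-\Lambda\hat y\|_{L^2(\mathbb{R}^n)}:\ y_\delta\in L^2(\mathbb{R}^n),\ \|y_\delta-y\|_{L^2(\mathbb{R}^n)}\le\delta\Big\}=0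 .$$ *)

theory Defs
  imports "HOL-Analysis.Analysis"
begin

text \<open>
  Elements of \<open>L\<^sup>2(\<real>\<^sup>n)\<close> are represented by Borel measurable, complex-valued functions;
  equality of classes is equality almost everywhere.
\<close>

definition L2 :: "(real ^ 'n \<Rightarrow> complex) set" where
  "L2 = {g. g \<in> borel_measurable lborel \<and> integrable lborel (\<lambda>x. (norm (g x))\<^sup>2)}"

text \<open>Meaningful on \<open>L2\<close> only: the Bochner integral of a non-integrable function is 0.\<close>

definition L2_norm :: "(real ^ 'n \<Rightarrow> complex) \<Rightarrow> real" where
  "L2_norm g = sqrt (\<integral>x. (norm (g x))\<^sup>2 \<partial>lborel)"

text \<open>
  Since classes are represented by functions, linearity is required almost everywhere.
  Together with boundedness it implies that almost everywhere equal arguments have almost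
  everywhere equal images.
\<close>

definition bounded_linear_L2 ::
    "((real ^ 'n \<Rightarrow> complex) \<Rightarrow> (real ^ 'n \<Rightarrow> complex)) \<Rightarrow> bool" where
  "bounded_linear_L2 T \<longleftrightarrow>
     (\<forall>g\<in>L2. T g \<in> L2) \<and>
     (\<forall>g\<in>L2. \<forall>h\<in>L2. AE \<xi> in lborel. T (\<lambda>x. g x + h x) \<xi> = T g \<xi> + T h \<xi>) \<and>
     (\<forall>c. \<forall>g\<in>L2. AE \<xi> in lborel. T (\<lambda>x. c * g x) \<xi> = c * T g \<xi>) \<and>
     (\<exists>C. \<forall>g\<in>L2. L2_norm (T g) \<le> C * L2_norm g)"

definition fourier_integral :: "(real ^ 'n \<Rightarrow> complex) \<Rightarrow> (real ^ 'n \<Rightarrow> complex)" where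
  "fourier_integral g \<xi> =
     of_real ((2 * pi) powr (- real CARD('n) / 2)) *
     (\<integral>x. exp (- \<i> * of_real (\<xi> \<bullet> x)) * g x \<partial>lborel)"

text \<open>
  The unitary extension of the Fourier integral to \<open>L\<^sup>2(\<real>\<^sup>n)\<close>: the \<open>L\<^sup>2\<close>-limit of the
  Fourier integrals of the truncations of \<open>g\<close> to the balls of radius \<open>k\<close>, which lie in
  \<open>L\<^sup>1 \<inter> L\<^sup>2\<close>. The limit is unique up to a null set and a representative is selected.
  The nonnegative integral makes the convergence meaningful without presupposing
  square-integrability of the difference.
\<close>

definition fourier :: "(real ^ 'n \<Rightarrow> complex) \<Rightarrow> (real ^ 'n \<Rightarrow> complex)" where
  "fourier g = (SOME h. h \<in> L2 \<and>
     (\<lambda>k. \<integral>\<^sup>+\<xi>. ennreal ((norm (h \<xi> -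
          fourier_integral (\<lambda>x. indicator (cball 0 (real k)) x * g x) \<xi>))\<^sup>2) \<partial>lborel)
       \<longlonglongrightarrow> 0)"

definition z_symbol :: "real \<Rightarrow> real ^ 'n \<Rightarrow> real \<Rightarrow> real ^ 'n \<Rightarrow> complex" where
  "z_symbol \<alpha> \<beta> \<nu> \<xi> =
     of_real (\<alpha>\<^sup>2 * (norm \<xi>)\<^sup>2) + \<i> * of_real (\<beta> \<bullet> \<xi>) + of_real \<nu>"

definition Lambda_symbol ::
    "real \<Rightarrow> real ^ 'n \<Rightarrow> real \<Rightarrow> real \<Rightarrow> real ^ 'n \<Rightarrow> complex" where
  "Lambda_symbol \<alpha> \<beta> \<nu> t0 \<xi> =
     z_symbol \<alpha> \<beta> \<nu> \<xi> / (1 - exp (- z_symbol \<alpha> \<beta> \<nu> \<xi> * of_real t0))"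

definition R_op ::
    "real \<Rightarrow> real ^ 'n \<Rightarrow> real \<Rightarrow> real \<Rightarrow> real \<Rightarrow>
     (real ^ 'n \<Rightarrow> complex) \<Rightarrow> (real ^ 'n \<Rightarrow> complex)" where
  "R_op \<alpha> \<beta> \<nu> t0 \<mu> g \<xi> =
     Lambda_symbol \<alpha> \<beta> \<nu> t0 \<xi> / of_real (1 + \<mu>\<^sup>2 * (norm \<xi>)\<^sup>2) * g \<xi>"

text \<open>
  The problem \<open>u\<^sub>t = \<alpha>\<^sup>2 \<Delta>u - \<beta> \<cdot> \<nabla>u - \<nu> u + f\<close>, \<open>u(\<cdot>, 0) = 0\<close>, understood in frequency
  space. Because \<open>fourier (u t)\<close> is determined only up to a null set depending on \<open>t\<close>,
  the equation in \<open>t\<close> is imposed, for almost every frequency \<open>\<xi>\<close>, on a function \<open>U\<close> that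
  represents \<open>fourier (u t)\<close> for every \<open>t\<close>. Continuity up to \<open>t = 0\<close> links the equation,
  which holds for \<open>t > 0\<close>, to the initial value.
\<close>

definition solves_evolution ::
    "real \<Rightarrow> real ^ 'n \<Rightarrow> real \<Rightarrow> (real ^ 'n \<Rightarrow> complex) \<Rightarrow>
     (real \<Rightarrow> real ^ 'n \<Rightarrow> complex) \<Rightarrow> bool" where
  "solves_evolution \<alpha> \<beta> \<nu> f u \<longleftrightarrow>
     (\<forall>t\<ge>0. u t \<in> L2) \<and>
     (\<exists>U. (\<forall>t\<ge>0. AE \<xi> in lborel. fourier (u t) \<xi> = U \<xi> t) \<and>
          (AE \<xi> in lborel.
             continuous_on {0..} (U \<xi>) \<and>
             U \<xi> 0 = 0 \<and>
             (\<forall>t>0. (U \<xi> has_vector_derivative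
                       (- z_symbol \<alpha> \<beta> \<nu> \<xi> * U \<xi> t + fourier f \<xi>)) (at t))))"

text \<open>
  The rule \<open>\<mu>\<close> depends on the noise level only; its values outside \<open>{0<..\<delta>M}\<close> are
  irrelevant. The supremum is taken in \<open>ennreal\<close>, so that an unbounded set of errors would
  have supremum \<open>\<infinity>\<close>. All errors are norms of elements of \<open>L2\<close>, by the first and third
  conjuncts below.
\<close>

definition apriori_rule :: "real \<Rightarrow> (real \<Rightarrow> real) \<Rightarrow> bool" where
  "apriori_rule \<delta>M \<mu> \<longleftrightarrow> (\<forall>\<delta>\<in>{0<..\<delta>M}. 0 < \<mu> \<delta>)"

definition convergent_regularization ::
    "(real ^ 'n \<Rightarrow> complex) \<Rightarrow>
     (real \<Rightarrow> (real ^ 'n \<Rightarrow> complex) \<Rightarrow> (real ^ 'n \<Rightarrow> complex)) \<Rightarrow>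
     (real \<Rightarrow> real) \<Rightarrow> (real ^ 'n \<Rightarrow> complex) \<Rightarrow> bool" where
  "convergent_regularization \<Lambda> R \<mu> y \<longleftrightarrow>
     (\<lambda>\<xi>. \<Lambda> \<xi> * fourier y \<xi>) \<in> L2 \<and>
     y \<in> L2 \<and>
     (\<forall>m>0. bounded_linear_L2 (R m)) \<and>
     (\<mu> \<longlongrightarrow> 0) (at_right 0) \<and>
     ((\<lambda>\<delta>. SUP y\<delta> \<in> {y\<delta> \<in> L2. L2_norm (\<lambda>x. y\<delta> x - y x) \<le> \<delta>}.
             ennreal (L2_norm (\<lambda>\<xi>. R (\<mu> \<delta>) (fourier y\<delta>) \<xi> - \<Lambda> \<xi> * fourier y \<xi>)))
        \<longlongrightarrow> 0) (at_right 0)"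

end

theory Submission
  imports Defs "HOL-Probability.Characteristic_Functions"
begin

text \<open>
  Solving the linear differential equation at each frequency gives
  \<open>z \<cdot> (fourier (u t0)) = (1 - exp (- z t0)) \<cdot> (fourier f)\<close> almost everywhere. Hence
  \<open>\<Lambda> \<cdot> (fourier y)\<close> is the transform of the source (\<open>fourier_source_eq\<close>), an element of
  \<open>L\<^sup>2\<close>. For a noisy datum the error splits as
  \<open>R\<^sub>\<mu> (fourier y\<delta>) - \<Lambda> (fourier y)
    = \<Lambda> / (1 + \<mu>\<^sup>2 |\<xi>|\<^sup>2) \<cdot> (fourier y\<delta> - fourier y)
      + (1 / (1 + \<mu>\<^sup>2 |\<xi>|\<^sup>2) - 1) \<cdot> \<Lambda> (fourier y)\<close>.

  The first term is propagated noise. The multiplier is bounded by a constant times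
  \<open>1 + 1 / \<mu>\<^sup>2\<close> (\<open>regularized_symbol_bound\<close>), because \<open>\<Lambda>\<close> grows quadratically, and the
  difference of the transforms is bounded by the noise level. The second term is the bias,
  which does not depend on the noisy datum and tends to 0 with \<open>\<mu>\<close> by dominated convergence
  (\<open>filter_bias_tendsto\<close>). So every rule with \<open>\<mu> \<longrightarrow> 0\<close> and \<open>\<delta> / \<mu>\<^sup>2 \<longrightarrow> 0\<close> succeeds; the proof
  takes \<open>\<mu> = \<delta> powr (1/4)\<close>.

  The analytic core is that the transform on \<open>L\<^sup>2\<close> exists as the limit that defines it
  (\<open>fourier_L2_limit\<close>) and is Lipschitz (\<open>fourier_Lipschitz\<close>). Both follow from
  Plancherel's inequality \<open>\<integral>|fourier_integral g|\<^sup>2 \<le> \<integral>|g|\<^sup>2\<close> for integrable \<open>g\<close>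
  (\<open>plancherel_inequality\<close>) together with completeness of \<open>L\<^sup>2\<close> (\<open>L2_complete\<close>). To prove the
  inequality, multiply the left integrand by the Gaussian \<open>exp (- \<sigma>\<^sup>2 |\<xi>|\<^sup>2 / 2)\<close>. Fubini's
  theorem turns the damped integral into a double integral of \<open>g(x) cnj (g(y))\<close> against
  the transform of that Gaussian at \<open>x - y\<close>, which is a multiple of a normal density.
  A kernel that is nonnegative and has mass 1 does not increase the square integral
  (\<open>gaussian_convolution_le\<close>), and \<open>\<sigma>\<close> is sent to 0 at the end.
\<close>

section \<open>Square integrals\<close>

text \<open>
  The squared \<open>L\<^sup>2\<close> norm, with value \<open>\<infinity>\<close> on measurable functions outside \<open>L\<^sup>2\<close>.
  Working with it in
  \<open>ennreal\<close> makes Tonelli, Fatou and dominated convergence available without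
  integrability side conditions, and the defining limit of \<open>fourier\<close> is of this form.
\<close>
definition sq_integral :: "('a::euclidean_space \<Rightarrow> complex) \<Rightarrow> ennreal" where
  "sq_integral g = (\<integral>\<^sup>+x. ennreal ((norm (g x))\<^sup>2) \<partial>lborel)"

lemma sq_integral_cong_AE:
  assumes "AE x in lborel. norm (g x) = norm (h x)"
  shows "sq_integral g = sq_integral h"
  unfolding sq_integral_def using assms by (intro nn_integral_cong_AE) auto

lemma sq_integral_mono_AE:
  assumes "AE x in lborel. norm (g x) \<le> norm (h x)"
  shows "sq_integral g \<le> sq_integral h"
  unfolding sq_integral_def using assms
  by (intro nn_integral_mono_AE) (auto intro!: ennreal_leI power_mono)

lemma sq_integral_minus_commute: "sq_integral (\<lambda>x. g x - h x) = sq_integral (\<lambda>x. h x - g x)"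
  by (simp add: sq_integral_def norm_minus_commute)

lemma sq_integral_cmult:
  assumes [measurable]: "g \<in> borel_measurable borel"
  shows "sq_integral (\<lambda>x. of_real c * g x) = ennreal (c\<^sup>2) * sq_integral g"
  unfolding sq_integral_def
  by (subst nn_integral_cmult[symmetric]) (auto simp: norm_mult power_mult_distrib ennreal_mult')

text \<open>
  A substitute for the triangle inequality, from \<open>(a + b)\<^sup>2 \<le> 2 a\<^sup>2 + 2 b\<^sup>2\<close>. It is
  linear in the squared norms, so no square roots of \<open>ennreal\<close> values occur; the price is
  the factor 2, which no limit below is sensitive to.
\<close>
lemma sq_integral_add_le:
  assumes [measurable]: "g \<in> borel_measurable borel" "h \<in> borel_measurable borel"
  shows "sq_integral (\<lambda>x. g x + h x) \<le> 2 * sq_integral g + 2 * sq_integral h"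
proof -
  have "(norm (g x + h x))\<^sup>2 \<le> 2 * (norm (g x))\<^sup>2 + 2 * (norm (h x))\<^sup>2" for x
  proof -
    have "(norm (g x + h x))\<^sup>2 \<le> (norm (g x) + norm (h x))\<^sup>2"
      by (intro power_mono norm_triangle_ineq) auto
    also have "\<dots> \<le> 2 * (norm (g x))\<^sup>2 + 2 * (norm (h x))\<^sup>2"
      using sum_squares_bound[of "norm (g x)" "norm (h x)"] by (simp add: power2_sum)
    finally show ?thesis .
  qed
  then have "sq_integral (\<lambda>x. g x + h x)
      \<le> (\<integral>\<^sup>+x. 2 * ennreal ((norm (g x))\<^sup>2) + 2 * ennreal ((norm (h x))\<^sup>2) \<partial>lborel)"
    unfolding sq_integral_def
    by (intro nn_integral_mono) (simp add: ennreal_mult'[symmetric] ennreal_plus[symmetric] ennreal_leI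
        ennreal_numeral[symmetric] del: ennreal_plus ennreal_numeral)
  also have "\<dots> = 2 * sq_integral g + 2 * sq_integral h"
    unfolding sq_integral_def by (simp add: nn_integral_add nn_integral_cmult)
  finally show ?thesis .
qed

lemma sq_integral_triangle:
  assumes [measurable]: "f \<in> borel_measurable borel" "g \<in> borel_measurable borel"
    "h \<in> borel_measurable borel"
  shows "sq_integral (\<lambda>x. f x - h x)
    \<le> 2 * sq_integral (\<lambda>x. f x - g x) + 2 * sq_integral (\<lambda>x. g x - h x)"
  using sq_integral_add_le[of "\<lambda>x. f x - g x" "\<lambda>x. g x - h x"] by simp

lemma L2_iff_sq_integral:
  "g \<in> L2 \<longleftrightarrow> g \<in> borel_measurable borel \<and> sq_integral g < \<infinity>"
  unfolding L2_def sq_integral_def by (auto simp: integrable_iff_bounded)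

lemma sq_integral_eq_L2_norm:
  assumes "g \<in> L2" shows "sq_integral g = ennreal ((L2_norm g)\<^sup>2)"
  using assms unfolding L2_def sq_integral_def L2_norm_def
  by (auto simp: nn_integral_eq_integral)

lemma L2_norm_le:
  assumes "g \<in> borel_measurable borel" "sq_integral g \<le> ennreal (r\<^sup>2)" "0 \<le> r"
  shows "L2_norm g \<le> r"
proof -
  have "g \<in> L2"
    using assms by (auto simp: L2_iff_sq_integral less_top[symmetric] top_unique)
  then have "(L2_norm g)\<^sup>2 \<le> r\<^sup>2"
    using assms(2) by (simp add: sq_integral_eq_L2_norm)
  then show ?thesis using assms(3) by (rule power2_le_imp_le)
qed

lemma L2_diff:
  assumes "g \<in> L2" "h \<in> L2" shows "(\<lambda>x. g x - h x) \<in> L2"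
  using sq_integral_add_le[of g "\<lambda>x. - h x"] assms
  by (auto simp: L2_iff_sq_integral sq_integral_def ennreal_mult_less_top intro: order.strict_trans1)

lemma L2_mult_bounded:
  assumes "g \<in> L2" "m \<in> borel_measurable borel" "\<And>x. norm (m x) \<le> C"
  shows "(\<lambda>x. m x * g x) \<in> L2" "sq_integral (\<lambda>x. m x * g x) \<le> ennreal (C\<^sup>2) * sq_integral g"
proof -
  have C: "0 \<le> C" using assms(3)[of undefined] norm_ge_zero order_trans by blast
  have g[measurable]: "g \<in> borel_measurable borel" and fin: "sq_integral g < \<infinity>"
    using assms(1) by (auto simp: L2_iff_sq_integral)
  have "sq_integral (\<lambda>x. m x * g x) \<le> sq_integral (\<lambda>x. of_real C * g x)"
    using C by (intro sq_integral_mono_AE) (auto simp: norm_mult intro!: mult_right_mono assms)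
  then show *: "sq_integral (\<lambda>x. m x * g x) \<le> ennreal (C\<^sup>2) * sq_integral g"
    by (simp add: sq_integral_cmult)
  have "ennreal (C\<^sup>2) * sq_integral g < \<infinity>" using fin by (simp add: ennreal_mult_less_top)
  with * show "(\<lambda>x. m x * g x) \<in> L2" using assms(2)
    by (auto simp: L2_iff_sq_integral intro: order.strict_trans1)
qed

section \<open>Gaussians and their Fourier integrals\<close>
lemma lborel_integral_prod:
  fixes f :: "'a::euclidean_space \<Rightarrow> real \<Rightarrow> complex"
  assumes "\<And>b. b \<in> Basis \<Longrightarrow> integrable lborel (f b)"
  shows "(\<integral>x. (\<Prod>b\<in>Basis. f b (x \<bullet> b)) \<partial>lborel) = (\<Prod>b\<in>Basis. \<integral>t. f b t \<partial>lborel)"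
proof -
  interpret product_sigma_finite "\<lambda>_::'a. lborel :: real measure" by standard
  have [measurable]: "\<And>b. b \<in> Basis \<Longrightarrow> f b \<in> borel_measurable borel"
    using assms by auto
  show ?thesis
    by (subst lborel_eq) (simp add: integral_distr product_integral_prod assms)
qed

text \<open>
  The rescaling \<open>t \<mapsto> t / \<sigma>\<close> turns this integral into the characteristic function of the
  standard normal distribution at \<open>- v / \<sigma>\<close>.
\<close>
lemma gaussian_fourier_integral_real:
  assumes "0 < \<sigma>"
  shows "(\<integral>t. exp (- \<i> * of_real (t * v)) * of_real (exp (- (\<sigma>\<^sup>2 * t\<^sup>2) / 2)) \<partial>lborel)
    = of_real (2 * pi * normal_density 0 \<sigma> v)"
proof -
  have "(\<integral>t. exp (- \<i> * of_real (t * v)) * of_real (exp (- (\<sigma>\<^sup>2 * t\<^sup>2) / 2)) \<partial>lborel)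
    = (1 / \<sigma>) *\<^sub>R (\<integral>t. exp (- \<i> * of_real (t / \<sigma> * v)) * of_real (exp (- t\<^sup>2 / 2)) \<partial>lborel)"
    using assms by (subst lborel_integral_real_affine[where c="1/\<sigma>" and t=0])
      (simp_all add: power_divide)
  also have "(\<integral>t. exp (- \<i> * of_real (t / \<sigma> * v)) * of_real (exp (- t\<^sup>2 / 2)) \<partial>lborel)
    = (\<integral>t. of_real (sqrt (2 * pi)) * (std_normal_density t *\<^sub>R iexp (- (v / \<sigma>) * t)) \<partial>lborel)"
    by (intro Bochner_Integration.integral_cong)
      (auto simp: std_normal_density_def scaleR_conv_of_real field_simps)
  also have "\<dots> = of_real (sqrt (2 * pi)) * (\<integral>t. std_normal_density t *\<^sub>R iexp (- (v / \<sigma>) * t) \<partial>lborel)"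
    by (rule integral_mult_right_zero)
  also have "(\<integral>t. std_normal_density t *\<^sub>R iexp (- (v / \<sigma>) * t) \<partial>lborel)
    = char std_normal_distribution (- (v / \<sigma>))"
    unfolding char_def by (subst integral_density) auto
  finally show ?thesis
    using assms unfolding char_std_normal_distribution
    by (simp add: normal_density_def scaleR_conv_of_real real_sqrt_mult field_simps power_divide
        flip: of_real_mult of_real_divide)
qed

definition gaussian_density :: "real \<Rightarrow> 'a::euclidean_space \<Rightarrow> real" where
  "gaussian_density \<sigma> x = (\<Prod>b\<in>Basis. normal_density 0 \<sigma> (x \<bullet> b))"

lemma gaussian_density_measurable [measurable]: "gaussian_density \<sigma> \<in> borel_measurable borel"
  unfolding gaussian_density_def by measurable

lemma gaussian_density_nonneg: "0 \<le> gaussian_density \<sigma> x"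
  unfolding gaussian_density_def by (intro prod_nonneg) auto

lemma nn_integral_gaussian_density:
  assumes "0 < \<sigma>"
  shows "(\<integral>\<^sup>+x. gaussian_density \<sigma> x \<partial>(lborel :: 'a::euclidean_space measure)) = 1"
proof -
  have "(\<integral>\<^sup>+x. gaussian_density \<sigma> x \<partial>(lborel :: 'a measure))
      = (\<integral>\<^sup>+x. (\<Prod>b\<in>Basis. ennreal (normal_density 0 \<sigma> (x \<bullet> b))) \<partial>(lborel :: 'a measure))"
    by (simp add: gaussian_density_def prod_ennreal)
  also have "\<dots> = 1"
    using assms by (subst nn_integral_lborel_prod) (auto simp: nn_integral_eq_integral)
  finally show ?thesis .
qed

lemma norm_power2_Basis: "(norm (x::'a::euclidean_space))\<^sup>2 = (\<Sum>b\<in>Basis. (x \<bullet> b)\<^sup>2)"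
  by (subst norm_eq_sqrt_inner, subst euclidean_inner) (simp add: power2_eq_square sum_nonneg)

lemma gaussian_integrable_real:
  assumes "0 < \<sigma>" shows "integrable lborel (\<lambda>t::real. exp (- (\<sigma>\<^sup>2 * t\<^sup>2) / 2))"
proof -
  have "exp (- (\<sigma>\<^sup>2 * t\<^sup>2) / 2) = sqrt (2 * pi * (1 / \<sigma>)\<^sup>2) * normal_density 0 (1 / \<sigma>) t" for t
    using assms by (simp add: normal_density_def power_divide field_simps)
  then show ?thesis using assms by simp
qed

lemma exp_gaussian_prod:
  "exp (- (\<sigma>\<^sup>2 * (norm (x::'a::euclidean_space))\<^sup>2) / 2) = (\<Prod>b\<in>Basis. exp (- (\<sigma>\<^sup>2 * (x \<bullet> b)\<^sup>2) / 2))"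
  unfolding norm_power2_Basis
  by (simp add: exp_sum[symmetric] sum_distrib_left sum_negf[symmetric] sum_divide_distrib)

lemma gaussian_integrable:
  assumes "0 < \<sigma>"
  shows "integrable lborel (\<lambda>x::'a::euclidean_space. exp (- (\<sigma>\<^sup>2 * (norm x)\<^sup>2) / 2))"
proof (rule integrableI_bounded)
  have "(\<integral>\<^sup>+x. ennreal (norm (exp (- (\<sigma>\<^sup>2 * (norm x)\<^sup>2) / 2))) \<partial>(lborel :: 'a measure))
      = (\<integral>\<^sup>+x. (\<Prod>b\<in>Basis. ennreal (exp (- (\<sigma>\<^sup>2 * (x \<bullet> b)\<^sup>2) / 2))) \<partial>(lborel :: 'a measure))"
    unfolding exp_gaussian_prod by (simp add: prod_ennreal abs_prod)
  also have "\<dots> = (\<Prod>b\<in>(Basis::'a set). \<integral>\<^sup>+t. ennreal (exp (- (\<sigma>\<^sup>2 * t\<^sup>2) / 2)) \<partial>lborel)"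
    by (subst nn_integral_lborel_prod) auto
  also have "\<dots> < \<infinity>"
    using gaussian_integrable_real[OF assms] by (auto simp: nn_integral_eq_integral ennreal_power less_top[symmetric])
  finally show "(\<integral>\<^sup>+x. ennreal (norm (exp (- (\<sigma>\<^sup>2 * (norm x)\<^sup>2) / 2))) \<partial>(lborel :: 'a measure)) < \<infinity>" .
qed measurable

text \<open>
  The transform of a damping Gaussian is a probability density up to the factor
  \<open>(2\<pi>)\<^sup>n\<close>. Its positivity and total mass 1 are what the proof of Plancherel's
  inequality uses. Both factors of the integrand split over the coordinates, so the
  one-dimensional formula suffices.
\<close>
lemma gaussian_fourier_integral:
  fixes v :: "'a::euclidean_space"
  assumes "0 < \<sigma>"
  shows "(\<integral>\<xi>. exp (- \<i> * of_real (\<xi> \<bullet> v)) * of_real (exp (- (\<sigma>\<^sup>2 * (norm \<xi>)\<^sup>2) / 2)) \<partial>lborel)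
    = of_real ((2 * pi) ^ DIM('a) * gaussian_density \<sigma> v)"
proof -
  let ?f = "\<lambda>b t. exp (- \<i> * of_real (t * (v \<bullet> b))) * of_real (exp (- (\<sigma>\<^sup>2 * t\<^sup>2) / 2)) :: complex"
  have int: "integrable lborel (?f b)" for b
    by (rule Bochner_Integration.integrable_bound[OF gaussian_integrable_real[OF assms]])
      (auto simp: norm_mult)
  have phase: "exp (- \<i> * of_real (\<xi> \<bullet> v)) = (\<Prod>b\<in>Basis. exp (- \<i> * of_real ((\<xi> \<bullet> b) * (v \<bullet> b))))" for \<xi> :: 'a
    by (subst euclidean_inner) (simp only: exp_sum[OF finite_Basis] of_real_sum sum_distrib_left)
  have "exp (- \<i> * of_real (\<xi> \<bullet> v)) * of_real (exp (- (\<sigma>\<^sup>2 * (norm \<xi>)\<^sup>2) / 2))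
      = (\<Prod>b\<in>Basis. ?f b (\<xi> \<bullet> b))" for \<xi> :: 'a
    unfolding phase exp_gaussian_prod by (simp only: prod.distrib of_real_prod)
  then have "(\<integral>\<xi>. exp (- \<i> * of_real (\<xi> \<bullet> v)) * of_real (exp (- (\<sigma>\<^sup>2 * (norm \<xi>)\<^sup>2) / 2)) \<partial>lborel)
      = (\<Prod>b\<in>(Basis::'a set). of_real (2 * pi * normal_density 0 \<sigma> (v \<bullet> b)))"
    using lborel_integral_prod[of ?f, OF int] gaussian_fourier_integral_real[OF assms] by simp
  then show ?thesis
    by (simp add: gaussian_density_def prod.distrib of_real_prod)
qed

section \<open>Plancherel's inequality for integrable functions\<close>
lemma fourier_integral_measurable [measurable]:
  assumes [measurable]: "g \<in> borel_measurable borel"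
  shows "fourier_integral g \<in> borel_measurable borel"
  unfolding fourier_integral_def
proof -
  have "(\<lambda>\<xi>. \<integral>x. exp (- \<i> * of_real (\<xi> \<bullet> x)) * g x \<partial>lborel) \<in> borel_measurable borel"
    by (rule lborel.borel_measurable_lebesgue_integral) measurable
  then show "(\<lambda>\<xi>. complex_of_real ((2 * pi) powr (- real CARD('a) / 2)) *
      (\<integral>x. exp (- \<i> * of_real (\<xi> \<bullet> x)) * g x \<partial>lborel)) \<in> borel_measurable borel"
    by measurable
qed

lemma integrable_exp_mult:
  fixes g :: "'a::euclidean_space \<Rightarrow> complex"
  assumes "integrable lborel g"
  shows "integrable lborel (\<lambda>x. exp (- \<i> * of_real (\<xi> \<bullet> x)) * g x)"
  using assms by (rule Bochner_Integration.integrable_bound) (use assms in \<open>auto simp: norm_mult\<close>)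

lemma fourier_integral_diff:
  assumes "integrable lborel g" "integrable lborel h"
  shows "fourier_integral (\<lambda>x. g x - h x) \<xi> = fourier_integral g \<xi> - fourier_integral h \<xi>"
  unfolding fourier_integral_def right_diff_distrib
    Bochner_Integration.integral_diff[OF integrable_exp_mult[OF assms(1)] integrable_exp_mult[OF assms(2)]] ..

lemma integrable_prod_lborel:
  fixes g :: "'a::euclidean_space \<Rightarrow> complex" and h :: "'b::euclidean_space \<Rightarrow> complex"
  assumes g: "integrable lborel g" and h: "integrable lborel h"
  shows "integrable (lborel \<Otimes>\<^sub>M lborel) (\<lambda>(x, y). g x * h y)"
proof (rule lborel_pair.Fubini_integrable)
  have [measurable]: "g \<in> borel_measurable borel" "h \<in> borel_measurable borel"
    using g h by auto
  show "(\<lambda>(x, y). g x * h y) \<in> borel_measurable (lborel \<Otimes>\<^sub>M lborel)" by measurable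
qed (use g h in \<open>auto simp: norm_mult\<close>)

text \<open>
  The square of the modulus of an integral, written as one integral over pairs, so that a
  single application of Fubini's theorem exchanges it with the integral over frequencies.
\<close>
lemma norm_square_integral:
  fixes g :: "'a::euclidean_space \<Rightarrow> complex"
  assumes g: "integrable lborel g"
  shows "of_real ((norm (\<integral>x. g x \<partial>lborel))\<^sup>2) = (\<integral>p. g (fst p) * cnj (g (snd p)) \<partial>lborel)"
proof -
  have "(\<integral>p. g (fst p) * cnj (g (snd p)) \<partial>lborel) = (\<integral>x. \<integral>y. g x * cnj (g y) \<partial>lborel \<partial>lborel)"
    using lborel_pair.integral_fst'[OF integrable_prod_lborel[OF g, of "\<lambda>y. cnj (g y)"]] g
    by (simp add: lborel_prod case_prod_beta')
  also have "\<dots> = (\<integral>x. g x \<partial>lborel) * cnj (\<integral>x. g x \<partial>lborel)"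
    by simp
  finally show ?thesis by (simp only: complex_norm_square)
qed

text \<open>
  Young's inequality for the kernel \<open>gaussian_density \<sigma> (x - y)\<close>: bound the product
  \<open>norm (g x) * norm (g y)\<close> by the mean of the two squares; each square then meets the
  kernel integrated over the other variable, which is 1 by translation and reflection
  invariance.
\<close>
lemma gaussian_convolution_le:
  fixes g :: "'a::euclidean_space \<Rightarrow> complex"
  assumes [measurable]: "g \<in> borel_measurable borel" and "0 < \<sigma>"
  shows "(\<integral>\<^sup>+p. ennreal (norm (g (fst p)) * norm (g (snd p)) * gaussian_density \<sigma> (fst p - snd p)) \<partial>lborel)
    \<le> sq_integral g"
proof -
  let ?N = "gaussian_density \<sigma> :: 'a \<Rightarrow> real"
  let ?q = "\<lambda>x. ennreal ((norm (g x))\<^sup>2)"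
  have shift: "(\<integral>\<^sup>+y. ennreal (?N (x - y)) \<partial>lborel) = 1" for x
  proof -
    have "(\<integral>\<^sup>+y. ennreal (?N (x - y)) \<partial>lborel)
        = (\<integral>\<^sup>+y. ennreal (?N (x - y)) \<partial>distr lborel borel (\<lambda>y. x + (-1) *\<^sub>R y))"
      by (subst lborel_affine[of "-1" x]) (simp_all add: density_1)
    also have "\<dots> = (\<integral>\<^sup>+y. ennreal (?N y) \<partial>lborel)"
      by (subst nn_integral_distr) auto
    finally show ?thesis using nn_integral_gaussian_density[OF \<open>0 < \<sigma>\<close>] by simp
  qed
  have shift': "(\<integral>\<^sup>+x. ennreal (?N (x - y)) \<partial>lborel) = 1" for y
  proof -
    have "(\<integral>\<^sup>+x. ennreal (?N (x - y)) \<partial>lborel)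
        = (\<integral>\<^sup>+x. ennreal (?N (x - y)) \<partial>distr lborel borel ((+) y))"
      by (simp add: lborel_distr_plus)
    also have "\<dots> = (\<integral>\<^sup>+y. ennreal (?N y) \<partial>lborel)"
      by (subst nn_integral_distr) auto
    finally show ?thesis using nn_integral_gaussian_density[OF \<open>0 < \<sigma>\<close>] by simp
  qed
  have young: "ennreal (norm (g x) * norm (g y) * ?N (x - y))
    \<le> ennreal (1/2) * (?q x * ennreal (?N (x - y)) + ?q y * ennreal (?N (x - y)))" for x y
  proof -
    have "norm (g x) * norm (g y) * ?N (x - y)
        \<le> (1/2) * ((norm (g x))\<^sup>2 * ?N (x - y) + (norm (g y))\<^sup>2 * ?N (x - y))"
      using mult_right_mono[OF sum_squares_bound[of "norm (g x)" "norm (g y)"] gaussian_density_nonneg[of \<sigma> "x - y"]]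
      by (simp add: algebra_simps)
    then have "ennreal (norm (g x) * norm (g y) * ?N (x - y))
        \<le> ennreal ((1/2) * ((norm (g x))\<^sup>2 * ?N (x - y) + (norm (g y))\<^sup>2 * ?N (x - y)))"
      by (rule ennreal_leI)
    also have "\<dots> = ennreal (1/2) * (?q x * ennreal (?N (x - y)) + ?q y * ennreal (?N (x - y)))"
      by (subst ennreal_mult) (auto simp: ennreal_mult gaussian_density_nonneg)
    finally show ?thesis .
  qed
  have half: "ennreal (1/2) * 2 = 1"
    using ennreal_mult[of "1/2" 2] by simp
  have a: "(\<integral>\<^sup>+x. \<integral>\<^sup>+y. ?q x * ennreal (?N (x - y)) \<partial>lborel \<partial>lborel) = sq_integral g"
    by (simp add: nn_integral_cmult shift sq_integral_def)
  have "(\<integral>\<^sup>+x. \<integral>\<^sup>+y. ?q y * ennreal (?N (x - y)) \<partial>lborel \<partial>lborel)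
      = (\<integral>\<^sup>+y. \<integral>\<^sup>+x. ?q y * ennreal (?N (x - y)) \<partial>lborel \<partial>lborel)"
    by (rule lborel_pair.Fubini') measurable
  also have "\<dots> = sq_integral g"
    by (simp add: nn_integral_cmult shift' sq_integral_def)
  finally have b: "(\<integral>\<^sup>+x. \<integral>\<^sup>+y. ?q y * ennreal (?N (x - y)) \<partial>lborel \<partial>lborel) = sq_integral g" .
  have "(\<integral>\<^sup>+p. ennreal (norm (g (fst p)) * norm (g (snd p)) * ?N (fst p - snd p)) \<partial>lborel)
      = (\<integral>\<^sup>+x. \<integral>\<^sup>+y. ennreal (norm (g x) * norm (g y) * ?N (x - y)) \<partial>lborel \<partial>lborel)"
    unfolding lborel_prod[symmetric] by (subst lborel.nn_integral_fst[symmetric]) auto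
  also have "\<dots> \<le> (\<integral>\<^sup>+x. \<integral>\<^sup>+y. ennreal (1/2) * (?q x * ennreal (?N (x - y)) + ?q y * ennreal (?N (x - y))) \<partial>lborel \<partial>lborel)"
    by (intro nn_integral_mono young)
  also have "\<dots> = ennreal (1/2) * ((\<integral>\<^sup>+x. \<integral>\<^sup>+y. ?q x * ennreal (?N (x - y)) \<partial>lborel \<partial>lborel)
      + (\<integral>\<^sup>+x. \<integral>\<^sup>+y. ?q y * ennreal (?N (x - y)) \<partial>lborel \<partial>lborel))"
    by (simp add: nn_integral_cmult nn_integral_add)
  also have "\<dots> = ennreal (1/2) * (sq_integral g + sq_integral g)"
    unfolding a b ..
  also have "\<dots> = sq_integral g"
    using half by (metis mult.assoc mult_2 mult_1)
  finally show ?thesis .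
qed

text \<open>
  The Gaussian weight makes the integrand absolutely integrable jointly in the frequency
  and the two space variables of the squared modulus. Integrating over the frequency
  first leaves \<open>\<integral>\<integral> g(x) cnj (g(y)) N(x - y) dx dy\<close> with the Gaussian density \<open>N\<close>, because
  the factor \<open>(2\<pi>)\<^sup>n\<close> cancels the normalisation of the transform.
\<close>
lemma fourier_integral_gaussian_bound:
  fixes g :: "real ^ 'n \<Rightarrow> complex"
  assumes g: "integrable lborel g" and \<sigma>: "0 < \<sigma>"
  shows "(\<integral>\<^sup>+\<xi>. ennreal ((norm (fourier_integral g \<xi>))\<^sup>2 * exp (- (\<sigma>\<^sup>2 * (norm \<xi>)\<^sup>2) / 2)) \<partial>lborel)
    \<le> sq_integral g"
proof -
  define c where "c = (2 * pi) powr (- real CARD('n) / 2)"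
  have c: "c\<^sup>2 * (2 * pi) ^ CARD('n) = 1"
  proof -
    have "c\<^sup>2 * (2 * pi) ^ CARD('n) = c * c * (2 * pi) powr (real CARD('n))"
      by (simp add: power2_eq_square powr_realpow)
    also have "\<dots> = (2 * pi) powr (- real CARD('n) / 2 + - real CARD('n) / 2 + real CARD('n))"
      by (simp only: c_def powr_add)
    finally show ?thesis by simp
  qed
  let ?G = "\<lambda>\<xi>::real^'n. exp (- (\<sigma>\<^sup>2 * (norm \<xi>)\<^sup>2) / 2)"
  let ?e = "\<lambda>(\<xi>::real^'n) x. exp (- \<i> * of_real (\<xi> \<bullet> x))"
  let ?H = "\<lambda>p. g (fst p) * cnj (g (snd p))"
  let ?F = "\<lambda>\<xi> p. ?e \<xi> (fst p - snd p) * of_real (?G \<xi>) * ?H p"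
  have gm[measurable]: "g \<in> borel_measurable borel" using g by auto
  have H: "integrable lborel ?H"
    using integrable_prod_lborel[OF g, of "\<lambda>y. cnj (g y)"] g by (simp add: lborel_prod case_prod_beta')
  have sq: "of_real ((norm (fourier_integral g \<xi>))\<^sup>2 * ?G \<xi>) = of_real (c\<^sup>2) * (\<integral>p. ?F \<xi> p \<partial>lborel)" for \<xi>
  proof -
    have "of_real ((norm (\<integral>x. ?e \<xi> x * g x \<partial>lborel))\<^sup>2)
        = (\<integral>p. ?e \<xi> (fst p) * g (fst p) * cnj (?e \<xi> (snd p) * g (snd p)) \<partial>lborel)"
      by (rule norm_square_integral[OF integrable_exp_mult[OF g]])
    also have "\<dots> = (\<integral>p. ?e \<xi> (fst p - snd p) * ?H p \<partial>lborel)"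
      by (intro Bochner_Integration.integral_cong)
        (auto simp: exp_cnj inner_diff_right exp_diff exp_minus field_simps)
    finally have *: "of_real ((norm (\<integral>x. ?e \<xi> x * g x \<partial>lborel))\<^sup>2)
        = (\<integral>p. ?e \<xi> (fst p - snd p) * ?H p \<partial>lborel)" .
    have "(\<integral>p. ?F \<xi> p \<partial>lborel) = of_real (?G \<xi>) * (\<integral>p. ?e \<xi> (fst p - snd p) * ?H p \<partial>lborel)"
      by (subst integral_mult_right_zero[symmetric]) (simp add: ac_simps)
    then show ?thesis
      unfolding *[symmetric] fourier_integral_def c_def[symmetric]
      by (simp add: norm_mult power_mult_distrib)
  qed
  have intF: "integrable (lborel \<Otimes>\<^sub>M lborel) (\<lambda>(\<xi>, p). ?F \<xi> p)"
  proof (rule Bochner_Integration.integrable_bound)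
    have "integrable lborel (\<lambda>\<xi>. complex_of_real (?G \<xi>))"
      using gaussian_integrable[OF \<sigma>, where 'a="real^'n"] by (rule integrable_of_real)
    then show "integrable (lborel \<Otimes>\<^sub>M lborel) (\<lambda>(\<xi>, p). of_real (?G \<xi>) * ?H p)"
      using H by (rule integrable_prod_lborel)
    have "(\<lambda>(\<xi>, p). ?e \<xi> (D p) * of_real (?G \<xi>) * h p) \<in> borel_measurable (lborel \<Otimes>\<^sub>M lborel)"
      if [measurable]: "D \<in> borel_measurable borel" "h \<in> borel_measurable borel"
      for D :: "(real^'n) \<times> (real^'n) \<Rightarrow> real^'n" and h :: "(real^'n) \<times> (real^'n) \<Rightarrow> complex"
      by measurable
    moreover have "(\<lambda>p. fst p - snd p :: real^'n) \<in> borel_measurable borel"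
      by (intro borel_measurable_continuous_onI continuous_intros)
    ultimately show "(\<lambda>(\<xi>, p). ?F \<xi> p) \<in> borel_measurable (lborel \<Otimes>\<^sub>M lborel)"
      using borel_measurable_integrable[OF H] by simp
  qed (auto simp: norm_mult)
  have int1: "integrable lborel (\<lambda>\<xi>. \<integral>p. ?F \<xi> p \<partial>lborel)"
    by (rule lborel_pair.integrable_fst[OF intF])
  then have "integrable lborel (\<lambda>\<xi>. complex_of_real ((norm (fourier_integral g \<xi>))\<^sup>2 * ?G \<xi>))"
    unfolding sq by simp
  then have int: "integrable lborel (\<lambda>\<xi>. (norm (fourier_integral g \<xi>))\<^sup>2 * ?G \<xi>)"
    by (simp only: complex_of_real_integrable_eq)
  have inner: "(\<integral>\<xi>. ?F \<xi> p \<partial>lborel) = of_real ((2 * pi) ^ CARD('n)) * (?H p * of_real (gaussian_density \<sigma> (fst p - snd p)))" for p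
    using gaussian_fourier_integral[OF \<sigma>, of "fst p - snd p"] by simp
  have "of_real (\<integral>\<xi>. (norm (fourier_integral g \<xi>))\<^sup>2 * ?G \<xi> \<partial>lborel)
      = of_real (c\<^sup>2) * (\<integral>\<xi>. \<integral>p. ?F \<xi> p \<partial>lborel \<partial>lborel)"
    unfolding integral_complex_of_real[symmetric] sq by (rule integral_mult_right_zero)
  also have "(\<integral>\<xi>. \<integral>p. ?F \<xi> p \<partial>lborel \<partial>lborel) = (\<integral>p. \<integral>\<xi>. ?F \<xi> p \<partial>lborel \<partial>lborel)"
    by (rule lborel_pair.Fubini_integral[OF intF, symmetric])
  also have "\<dots> = of_real ((2 * pi) ^ CARD('n)) * (\<integral>p. ?H p * of_real (gaussian_density \<sigma> (fst p - snd p)) \<partial>lborel)"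
    unfolding inner by (rule integral_mult_right_zero)
  also have "of_real (c\<^sup>2) * \<dots> = of_real (c\<^sup>2 * (2 * pi) ^ CARD('n)) * (\<integral>p. ?H p * of_real (gaussian_density \<sigma> (fst p - snd p)) \<partial>lborel)"
    by simp
  finally have eq: "of_real (\<integral>\<xi>. (norm (fourier_integral g \<xi>))\<^sup>2 * ?G \<xi> \<partial>lborel)
      = (\<integral>p. ?H p * of_real (gaussian_density \<sigma> (fst p - snd p)) \<partial>lborel)"
    unfolding c by simp
  have "(\<integral>\<^sup>+\<xi>. ennreal ((norm (fourier_integral g \<xi>))\<^sup>2 * ?G \<xi>) \<partial>lborel)
      = ennreal (\<integral>\<xi>. (norm (fourier_integral g \<xi>))\<^sup>2 * ?G \<xi> \<partial>lborel)"
    using int by (rule nn_integral_eq_integral) auto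
  also have "\<dots> = ennreal (norm (complex_of_real (\<integral>\<xi>. (norm (fourier_integral g \<xi>))\<^sup>2 * ?G \<xi> \<partial>lborel)))"
    by (subst norm_of_real, subst abs_of_nonneg) auto
  also have "\<dots> \<le> (\<integral>\<^sup>+p. ennreal (norm (?H p * of_real (gaussian_density \<sigma> (fst p - snd p)))) \<partial>lborel)"
  proof (cases "integrable lborel (\<lambda>p. ?H p * complex_of_real (gaussian_density \<sigma> (fst p - snd p)))")
    case True
    then show ?thesis unfolding eq by (rule integral_norm_bound_ennreal)
  next
    case False
    then show ?thesis unfolding eq by (simp add: not_integrable_integral_eq)
  qed
  also have "\<dots> = (\<integral>\<^sup>+p. ennreal (norm (g (fst p)) * norm (g (snd p)) * gaussian_density \<sigma> (fst p - snd p)) \<partial>lborel)"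
    by (simp add: norm_mult gaussian_density_nonneg)
  also have "\<dots> \<le> sq_integral g"
    by (rule gaussian_convolution_le[OF gm \<sigma>])
  finally show ?thesis .
qed

text \<open>The damping is removed by Fatou's lemma, with the bound uniform in \<open>\<sigma> = 1 / (k + 1)\<close>.\<close>
lemma plancherel_inequality:
  fixes g :: "real ^ 'n \<Rightarrow> complex"
  assumes "integrable lborel g"
  shows "sq_integral (fourier_integral g) \<le> sq_integral g"
proof -
  let ?\<sigma> = "\<lambda>k. 1 / real (Suc k)"
  have [measurable]: "g \<in> borel_measurable borel" using assms by auto
  let ?u = "\<lambda>k \<xi>. ennreal ((norm (fourier_integral g \<xi>))\<^sup>2 * exp (- ((?\<sigma> k)\<^sup>2 * (norm \<xi>)\<^sup>2) / 2))"
  have "(\<lambda>k. ?u k \<xi>) \<longlonglongrightarrow> ennreal ((norm (fourier_integral g \<xi>))\<^sup>2)" for \<xi>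
  proof -
    have "?\<sigma> \<longlonglongrightarrow> 0" using LIMSEQ_inverse_real_of_nat by (simp add: inverse_eq_divide)
    then have "(\<lambda>k. (norm (fourier_integral g \<xi>))\<^sup>2 * exp (- ((?\<sigma> k)\<^sup>2 * (norm \<xi>)\<^sup>2) / 2))
      \<longlonglongrightarrow> (norm (fourier_integral g \<xi>))\<^sup>2 * exp (- (0\<^sup>2 * (norm \<xi>)\<^sup>2) / 2)"
      by (intro tendsto_intros) auto
    then show ?thesis by (intro tendsto_ennrealI) simp
  qed
  then have "sq_integral (fourier_integral g) = (\<integral>\<^sup>+\<xi>. liminf (\<lambda>k. ?u k \<xi>) \<partial>lborel)"
    unfolding sq_integral_def by (intro nn_integral_cong) (metis lim_imp_Liminf sequentially_bot)
  also have "\<dots> \<le> liminf (\<lambda>k. \<integral>\<^sup>+\<xi>. ?u k \<xi> \<partial>lborel)"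
    by (rule nn_integral_liminf) measurable
  also have "\<dots> \<le> liminf (\<lambda>k. sq_integral g)"
    by (intro Liminf_mono always_eventually allI fourier_integral_gaussian_bound assms) auto
  also have "\<dots> = sq_integral g" by (simp add: Liminf_const)
  finally show ?thesis .
qed

section \<open>Completeness of the space of square-integrable functions\<close>
lemma fast_subsequence:
  fixes b :: "nat \<Rightarrow> ennreal"
  assumes "b \<longlonglongrightarrow> 0" and "\<And>j. 0 < c j"
  obtains r :: "nat \<Rightarrow> nat" where "strict_mono r" "\<And>j. b (r j) \<le> c j"
proof -
  have "\<exists>N. \<forall>n\<ge>N. b n \<le> c j" for j
    using order_tendstoD(2)[OF assms(1) assms(2)[of j]]
    by (auto simp: eventually_sequentially intro: less_imp_le)
  then obtain N where N: "\<And>j n. N j \<le> n \<Longrightarrow> b n \<le> c j" by metis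
  define r where "r j = (\<Sum>i\<le>j. N i) + j" for j
  have "strict_mono r"
    by (rule strict_mono_Suc_iff[THEN iffD2]) (simp add: r_def)
  moreover have "b (r j) \<le> c j" for j
    by (rule N) (simp add: r_def member_le_sum trans_le_add1)
  ultimately show ?thesis using that by blast
qed

text \<open>
  The Riesz--Fischer argument. Along a subsequence with squared increments at most
  \<open>4 ^ -j\<close> in the mean, the series \<open>\<Sum>j. 2 ^ j * (d j x)\<^sup>2\<close> has a finite integral, which
  forces the increments \<open>d j x\<close> to be summable for almost every \<open>x\<close>. The pointwise limit is
  also the limit in the mean by Fatou's lemma. The Cauchy condition is given by a
  modulus \<open>b\<close>, the form in which it arises for truncations.
\<close>
lemma L2_complete:
  fixes F :: "nat \<Rightarrow> 'a::euclidean_space \<Rightarrow> complex"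
  assumes [measurable]: "\<And>k. F k \<in> borel_measurable borel"
    and Cauchy: "\<And>m k. m \<le> k \<Longrightarrow> sq_integral (\<lambda>x. F k x - F m x) \<le> b m"
    and b: "b \<longlonglongrightarrow> 0"
  obtains h where "h \<in> borel_measurable borel" "(\<lambda>k. sq_integral (\<lambda>x. h x - F k x)) \<longlonglongrightarrow> 0"
proof -
  obtain r :: "nat \<Rightarrow> nat" where r: "strict_mono r" and br: "\<And>j. b (r j) \<le> ennreal ((1/4) ^ j)"
    using fast_subsequence[OF b, of "\<lambda>j. ennreal ((1/4) ^ j)"] by auto
  define d where "d j x = norm (F (r (Suc j)) x - F (r j) x)" for j x
  have [measurable]: "d j \<in> borel_measurable borel" for j
    unfolding d_def by measurable
  have "(\<integral>\<^sup>+x. (\<Sum>j. ennreal (2 ^ j * (d j x)\<^sup>2)) \<partial>lborel) = (\<Sum>j. \<integral>\<^sup>+x. ennreal (2 ^ j * (d j x)\<^sup>2) \<partial>lborel)"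
    by (rule nn_integral_suminf) measurable
  also have "\<dots> \<le> (\<Sum>j. ennreal ((1/2) ^ j))"
  proof (rule suminf_le)
    fix j
    have "(\<integral>\<^sup>+x. ennreal (2 ^ j * (d j x)\<^sup>2) \<partial>lborel) = ennreal (2 ^ j) * sq_integral (\<lambda>x. F (r (Suc j)) x - F (r j) x)"
      unfolding sq_integral_def d_def by (subst nn_integral_cmult[symmetric]) (auto simp: ennreal_mult)
    also have "\<dots> \<le> ennreal (2 ^ j) * ennreal ((1/4) ^ j)"
      using Cauchy[of "r j" "r (Suc j)"] br[of j] r
      by (intro mult_left_mono order_trans[OF Cauchy br]) (auto simp: strict_mono_less_eq)
    also have "\<dots> = ennreal ((2 * (1/4)) ^ j)"
      by (subst ennreal_mult[symmetric]) (auto simp: power_mult_distrib[symmetric])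
    finally show "(\<integral>\<^sup>+x. ennreal (2 ^ j * (d j x)\<^sup>2) \<partial>lborel) \<le> ennreal ((1/2) ^ j)" by simp
  qed auto
  also have "\<dots> = ennreal (\<Sum>j. (1/2) ^ j)"
    by (rule suminf_ennreal2) (auto simp: summable_geometric)
  finally have fin: "(\<integral>\<^sup>+x. (\<Sum>j. ennreal (2 ^ j * (d j x)\<^sup>2)) \<partial>lborel) \<noteq> \<infinity>"
    by (auto simp: top_unique)
  have "AE x in lborel. (\<Sum>j. ennreal (2 ^ j * (d j x)\<^sup>2)) \<noteq> \<infinity>"
    by (rule nn_integral_PInf_AE[OF _ fin]) measurable
  then have conv: "AE x in lborel. convergent (\<lambda>j. F (r j) x)"
  proof eventually_elim
    case (elim x)
    then have s: "summable (\<lambda>j. 2 ^ j * (d j x)\<^sup>2)"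
      by (intro summable_suminf_not_top) auto
    \<comment> \<open>Either \<open>d j x\<close> is below the threshold \<open>2 ^ -j\<close>, or multiplying it by \<open>2 ^ j * d j x\<close>
        increases it.\<close>
    have "d j x \<le> (1/2) ^ j + 2 ^ j * (d j x)\<^sup>2" for j
    proof (cases "d j x \<le> (1/2) ^ j")
      case False
      then have "1 \<le> 2 ^ j * d j x" by (simp add: power_divide field_simps)
      from mult_right_mono[OF this, of "d j x"] have "d j x \<le> 2 ^ j * (d j x)\<^sup>2"
        by (simp add: d_def power2_eq_square mult.assoc)
      then show ?thesis by (simp add: add_increasing)
    qed (simp add: add_increasing2)
    then have "summable (\<lambda>j. F (r (Suc j)) x - F (r j) x)"
      using s by (intro summable_comparison_test[OF _ summable_add[OF summable_geometric[of "1/2::real"] s]])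
        (auto simp: d_def)
    from summable_LIMSEQ[OF this] have "convergent (\<lambda>j. F (r j) x - F (r 0) x)"
      unfolding sum_lessThan_telescope[of "\<lambda>j. F (r j) x"] convergent_def by blast
    from convergent_add[OF this convergent_const[of "F (r 0) x"]] show ?case by simp
  qed
  define h where "h x = lim (\<lambda>j. F (r j) x)" for x
  have [measurable]: "h \<in> borel_measurable borel"
    unfolding h_def by measurable
  have "sq_integral (\<lambda>x. h x - F m x) \<le> b m" for m
  proof -
    have "sq_integral (\<lambda>x. h x - F m x)
        = (\<integral>\<^sup>+x. liminf (\<lambda>j. ennreal ((norm (F (r j) x - F m x))\<^sup>2)) \<partial>lborel)"
      unfolding sq_integral_def
    proof (rule nn_integral_cong_AE, use conv in eventually_elim)
      case (elim x)
      then have "(\<lambda>j. F (r j) x) \<longlonglongrightarrow> h x"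
        unfolding h_def by (simp add: convergent_LIMSEQ_iff)
      then have "(\<lambda>j. ennreal ((norm (F (r j) x - F m x))\<^sup>2)) \<longlonglongrightarrow> ennreal ((norm (h x - F m x))\<^sup>2)"
        by (intro tendsto_ennrealI tendsto_intros)
      then show ?case by (metis lim_imp_Liminf sequentially_bot)
    qed
    also have "\<dots> \<le> liminf (\<lambda>j. sq_integral (\<lambda>x. F (r j) x - F m x))"
      unfolding sq_integral_def by (rule nn_integral_liminf) measurable
    also have "\<dots> \<le> liminf (\<lambda>j. b m)"
    proof (rule Liminf_mono)
      show "\<forall>\<^sub>F j in sequentially. sq_integral (\<lambda>x. F (r j) x - F m x) \<le> b m"
        using eventually_ge_at_top[of m]
        by eventually_elim (use Cauchy strict_mono_imp_increasing[OF r] order_trans in blast)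
    qed
    finally show ?thesis by (simp add: Liminf_const)
  qed
  then have "(\<lambda>k. sq_integral (\<lambda>x. h x - F k x)) \<longlonglongrightarrow> 0"
    by (intro tendsto_sandwich[OF _ _ tendsto_const b]) auto
  then show ?thesis by (rule that[rotated]) measurable
qed

section \<open>The Fourier transform on the space of square-integrable functions\<close>
definition ball_truncation :: "nat \<Rightarrow> ('a::euclidean_space \<Rightarrow> complex) \<Rightarrow> 'a \<Rightarrow> complex" where
  "ball_truncation k g x = indicator (cball 0 (real k)) x * g x"

lemma ball_truncation_measurable [measurable]:
  "g \<in> borel_measurable borel \<Longrightarrow> ball_truncation k g \<in> borel_measurable borel"
  unfolding ball_truncation_def[abs_def] by (intro borel_measurable_times borel_measurable_indicator) auto

lemma le_one_plus_square: "a \<le> 1 + a\<^sup>2" for a :: real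
  using zero_le_power2[of "a - 1/2"] by (simp add: power2_eq_square algebra_simps)

text \<open>
  Square-integrable functions are locally integrable: \<open>a \<le> 1 + a\<^sup>2\<close>, and balls have finite
  measure.
\<close>
lemma ball_truncation_integrable:
  assumes "g \<in> L2" shows "integrable lborel (ball_truncation k g)"
proof (rule Bochner_Integration.integrable_bound)
  show "integrable lborel (\<lambda>x. indicator (cball 0 (real k)) x + (norm (g x))\<^sup>2)"
    using assms emeasure_lborel_cball_finite[of 0 "real k"] unfolding L2_def
    by (auto intro!: Bochner_Integration.integrable_add integrable_real_indicator)
  show "ball_truncation k g \<in> borel_measurable lborel"
    using assms by (auto simp: L2_def)
  show "AE x in lborel. norm (ball_truncation k g x) \<le> norm (indicator (cball 0 (real k)) x + (norm (g x))\<^sup>2)"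
    by (auto simp: ball_truncation_def indicator_def le_one_plus_square)
qed

lemma ball_truncation_tendsto:
  fixes g :: "real ^ 'n \<Rightarrow> complex"
  assumes "g \<in> L2" shows "(\<lambda>k. sq_integral (\<lambda>x. g x - ball_truncation k g x)) \<longlonglongrightarrow> 0"
proof -
  have [measurable]: "g \<in> borel_measurable borel" and fin: "sq_integral g < \<infinity>"
    using assms by (auto simp: L2_iff_sq_integral)
  have "(\<lambda>k. \<integral>\<^sup>+x. ennreal ((norm (g x - ball_truncation k g x))\<^sup>2) \<partial>lborel)
      \<longlonglongrightarrow> (\<integral>\<^sup>+x. 0 \<partial>(lborel :: (real^'n) measure))"
  proof (rule nn_integral_dominated_convergence)
    show "(\<integral>\<^sup>+x. ennreal ((norm (g x))\<^sup>2) \<partial>lborel) < \<infinity>" using fin by (simp add: sq_integral_def)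
    show "AE x in lborel. (\<lambda>k. ennreal ((norm (g x - ball_truncation k g x))\<^sup>2)) \<longlonglongrightarrow> 0"
    proof (rule AE_I2, rule tendsto_eventually)
      fix x :: "real^'n"
      obtain k0 :: nat where "norm x \<le> real k0" using real_arch_simple by blast
      then show "\<forall>\<^sub>F k in sequentially. ennreal ((norm (g x - ball_truncation k g x))\<^sup>2) = 0"
        unfolding eventually_sequentially by (intro exI[of _ k0]) (auto simp: ball_truncation_def)
    qed
  qed (auto simp: ball_truncation_def indicator_def)
  then show ?thesis by (simp add: sq_integral_def)
qed

lemma ball_truncation_Cauchy:
  assumes "m \<le> k"
  shows "sq_integral (\<lambda>x. ball_truncation k g x - ball_truncation m g x) \<le> sq_integral (\<lambda>x. g x - ball_truncation m g x)"
  using assms by (intro sq_integral_mono_AE) (auto simp: ball_truncation_def indicator_def)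

text \<open>
  The function selected by \<open>fourier\<close> exists: the truncations of \<open>g\<close> are Cauchy in \<open>L\<^sup>2\<close>,
  Plancherel's inequality carries this over to their Fourier integrals, and
  completeness provides the limit.
\<close>
lemma fourier_L2_limit:
  fixes g :: "real ^ 'n \<Rightarrow> complex"
  assumes g: "g \<in> L2"
  shows "fourier g \<in> L2"
    and "(\<lambda>k. sq_integral (\<lambda>\<xi>. fourier g \<xi> - fourier_integral (ball_truncation k g) \<xi>)) \<longlonglongrightarrow> 0"
proof -
  have [measurable]: "g \<in> borel_measurable borel"
    using g by (auto simp: L2_iff_sq_integral)
  let ?F = "\<lambda>k. fourier_integral (ball_truncation k g)"
  have "sq_integral (\<lambda>\<xi>. ?F k \<xi> - ?F m \<xi>) \<le> sq_integral (\<lambda>x. g x - ball_truncation m g x)" if "m \<le> k" for m k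
  proof -
    have "sq_integral (\<lambda>\<xi>. ?F k \<xi> - ?F m \<xi>)
        = sq_integral (fourier_integral (\<lambda>x. ball_truncation k g x - ball_truncation m g x))"
      using fourier_integral_diff[OF ball_truncation_integrable[OF g] ball_truncation_integrable[OF g]]
      by (simp add: sq_integral_def)
    also have "\<dots> \<le> sq_integral (\<lambda>x. ball_truncation k g x - ball_truncation m g x)"
      using ball_truncation_integrable[OF g] by (intro plancherel_inequality) simp
    also have "\<dots> \<le> sq_integral (\<lambda>x. g x - ball_truncation m g x)"
      using that by (rule ball_truncation_Cauchy)
    finally show ?thesis .
  qed
  then obtain h where h[measurable]: "h \<in> borel_measurable borel"
    and lim: "(\<lambda>k. sq_integral (\<lambda>\<xi>. h \<xi> - ?F k \<xi>)) \<longlonglongrightarrow> 0"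
    using L2_complete[of ?F "\<lambda>m. sq_integral (\<lambda>x. g x - ball_truncation m g x)"] ball_truncation_tendsto[OF g]
    by auto
  have "\<forall>\<^sub>F k in sequentially. sq_integral (\<lambda>\<xi>. h \<xi> - ?F k \<xi>) < 1"
    using lim by (rule order_tendstoD) simp
  then obtain k where k: "sq_integral (\<lambda>\<xi>. h \<xi> - ?F k \<xi>) < 1"
    by (auto simp: eventually_sequentially)
  have "sq_integral (?F k) \<le> sq_integral (ball_truncation k g)"
    by (intro plancherel_inequality ball_truncation_integrable g)
  also have "\<dots> \<le> sq_integral g"
    by (intro sq_integral_mono_AE) (auto simp: ball_truncation_def indicator_def)
  finally have "sq_integral (?F k) < \<infinity>"
    using g by (auto simp: L2_iff_sq_integral)
  with k have "2 * sq_integral (\<lambda>\<xi>. h \<xi> - ?F k \<xi>) + 2 * sq_integral (?F k) < \<infinity>"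
    by (auto simp: ennreal_mult_less_top intro: less_trans)
  with sq_integral_add_le[of "\<lambda>\<xi>. h \<xi> - ?F k \<xi>" "?F k"] have "h \<in> L2"
    by (auto simp: L2_iff_sq_integral intro: order.strict_trans1)
  with lim have "\<exists>h. h \<in> L2 \<and> (\<lambda>k. sq_integral (\<lambda>\<xi>. h \<xi> - ?F k \<xi>)) \<longlonglongrightarrow> 0"
    by blast
  from someI_ex[OF this] show "fourier g \<in> L2"
    "(\<lambda>k. sq_integral (\<lambda>\<xi>. fourier g \<xi> - ?F k \<xi>)) \<longlonglongrightarrow> 0"
    unfolding fourier_def sq_integral_def ball_truncation_def[abs_def] by blast+
qed

text \<open>
  Plancherel's inequality for the truncations of \<open>g\<close> and \<open>h\<close>, passed to the limit. The
  factor 4 arises from two uses of \<open>sq_integral_triangle\<close>.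
\<close>
lemma fourier_Lipschitz:
  fixes g h :: "real ^ 'n \<Rightarrow> complex"
  assumes g: "g \<in> L2" and h: "h \<in> L2"
  shows "sq_integral (\<lambda>\<xi>. fourier g \<xi> - fourier h \<xi>) \<le> 4 * sq_integral (\<lambda>x. g x - h x)"
proof -
  have [measurable]: "g \<in> borel_measurable borel" "h \<in> borel_measurable borel"
    "fourier g \<in> borel_measurable borel" "fourier h \<in> borel_measurable borel"
    using g h fourier_L2_limit(1)[OF g] fourier_L2_limit(1)[OF h] by (auto simp: L2_iff_sq_integral)
  let ?G = "\<lambda>k. fourier_integral (ball_truncation k g)" and ?H = "\<lambda>k. fourier_integral (ball_truncation k h)"
  let ?eG = "\<lambda>k. sq_integral (\<lambda>\<xi>. fourier g \<xi> - ?G k \<xi>)"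
  let ?eH = "\<lambda>k. sq_integral (\<lambda>\<xi>. fourier h \<xi> - ?H k \<xi>)"
  let ?d = "sq_integral (\<lambda>x. g x - h x)"
  have bound: "sq_integral (\<lambda>\<xi>. fourier g \<xi> - fourier h \<xi>) \<le> 2 * ?eG k + 2 * (2 * ?d + 2 * ?eH k)" for k
  proof -
    have "sq_integral (\<lambda>\<xi>. ?G k \<xi> - ?H k \<xi>)
        = sq_integral (fourier_integral (\<lambda>x. ball_truncation k g x - ball_truncation k h x))"
      using fourier_integral_diff[OF ball_truncation_integrable[OF g] ball_truncation_integrable[OF h]]
      by (simp add: sq_integral_def)
    also have "\<dots> \<le> sq_integral (\<lambda>x. ball_truncation k g x - ball_truncation k h x)"
      using ball_truncation_integrable[OF g] ball_truncation_integrable[OF h] by (intro plancherel_inequality) simp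
    also have "\<dots> \<le> ?d"
      by (intro sq_integral_mono_AE) (auto simp: ball_truncation_def indicator_def)
    finally have GH: "sq_integral (\<lambda>\<xi>. ?G k \<xi> - ?H k \<xi>) \<le> ?d" .
    have "sq_integral (\<lambda>\<xi>. fourier g \<xi> - fourier h \<xi>)
        \<le> 2 * ?eG k + 2 * sq_integral (\<lambda>\<xi>. ?G k \<xi> - fourier h \<xi>)"
      by (rule sq_integral_triangle) measurable
    also have "sq_integral (\<lambda>\<xi>. ?G k \<xi> - fourier h \<xi>)
        \<le> 2 * sq_integral (\<lambda>\<xi>. ?G k \<xi> - ?H k \<xi>) + 2 * sq_integral (\<lambda>\<xi>. ?H k \<xi> - fourier h \<xi>)"
      by (rule sq_integral_triangle) measurable
    also have "\<dots> \<le> 2 * ?d + 2 * ?eH k"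
      using GH by (subst sq_integral_minus_commute[of "?H k"]) (intro add_mono mult_left_mono; simp)
    finally show ?thesis by (simp add: add_mono mult_left_mono)
  qed
  have "(\<lambda>k. 2 * ?eG k + 2 * (2 * ?d + 2 * ?eH k)) \<longlonglongrightarrow> 2 * 0 + 2 * (2 * ?d + 2 * 0)"
    by (intro tendsto_add ennreal_tendsto_cmult tendsto_const fourier_L2_limit g h) auto
  from LIMSEQ_le_const[OF this] bound
  have "sq_integral (\<lambda>\<xi>. fourier g \<xi> - fourier h \<xi>) \<le> 2 * 0 + 2 * (2 * ?d + 2 * 0)" by blast
  then show ?thesis by (simp add: mult.assoc[symmetric])
qed

section \<open>The source in terms of the datum\<close>

text \<open>
  The function \<open>exp (z t) (z V t - c)\<close> has derivative 0 for positive \<open>t\<close> and is continuous at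
  0, so it keeps its initial value \<open>- c\<close>.
\<close>
lemma linear_ode_solution:
  fixes V :: "real \<Rightarrow> complex"
  assumes cont: "continuous_on {0..} V" and V0: "V 0 = 0"
    and deriv: "\<And>t. 0 < t \<Longrightarrow> (V has_vector_derivative (- z * V t + c)) (at t)"
    and T: "0 \<le> T"
  shows "z * V T = (1 - exp (- z * of_real T)) * c"
proof -
  define W where "W t = exp (z * of_real t) * (z * V t - c)" for t :: real
  have "W T = - c"
  proof (rule has_derivative_zero_unique_strong_interval[of "{0}" 0 T W])
    show "continuous_on {0..T} W"
      unfolding W_def by (intro continuous_intros continuous_on_subset[OF cont]) auto
    fix t assume "t \<in> {0..T} - {0}"
    then have "0 < t" by auto
    have "((\<lambda>t. exp (z * of_real t)) has_vector_derivative (z * exp (z * of_real t))) (at t)"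
      by (rule has_vector_derivative_real_field) (auto intro!: derivative_eq_intros)
    note this[THEN has_vector_derivative_mult, OF has_vector_derivative_diff[OF
        has_vector_derivative_mult_right[OF deriv[OF \<open>0 < t\<close>]] has_vector_derivative_const]]
    then have "(W has_vector_derivative 0) (at t)"
      unfolding W_def[abs_def] by (rule has_vector_derivative_eq_rhs) (simp add: algebra_simps)
    then show "(W has_derivative (\<lambda>h. 0)) (at t within {0..T})"
      by (auto simp: has_vector_derivative_def intro: has_derivative_at_withinI)
  qed (use T in \<open>auto simp: W_def V0\<close>)
  then have "exp (- z * of_real T) * (exp (z * of_real T) * (z * V T - c)) = exp (- z * of_real T) * (- c)"
    unfolding W_def by simp
  then have "z * V T - c = - (exp (- z * of_real T) * c)"
    by (simp add: mult.assoc[symmetric] exp_add[symmetric])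
  then show ?thesis by (simp add: algebra_simps)
qed

text \<open>
  Since the real part of the symbol is at least \<open>\<nu>\<close>, the denominator of
  \<open>Lambda_symbol\<close> is bounded away from 0 uniformly in the frequency.
\<close>
lemma one_minus_exp_ge:
  assumes "0 < \<nu>" "0 < t0"
  shows "1 - exp (- \<nu> * t0) \<le> norm (1 - exp (- z_symbol \<alpha> \<beta> \<nu> \<xi> * of_real t0))"
proof -
  have "\<nu> \<le> Re (z_symbol \<alpha> \<beta> \<nu> \<xi>)" by (simp add: z_symbol_def)
  then have "norm (exp (- z_symbol \<alpha> \<beta> \<nu> \<xi> * of_real t0)) \<le> exp (- \<nu> * t0)"
    using assms by simp
  then show ?thesis
    using norm_triangle_ineq2[of 1 "exp (- z_symbol \<alpha> \<beta> \<nu> \<xi> * of_real t0)"]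
    unfolding norm_one by linarith
qed

text \<open>
  The frequency-space equation at time \<open>t0\<close>, divided by the nonzero factor
  \<open>1 - exp (- z t0)\<close>.
\<close>
lemma fourier_source_eq:
  fixes \<beta> :: "real ^ 'n"
  assumes "0 < \<nu>" "0 < t0" "solves_evolution \<alpha> \<beta> \<nu> f u"
  shows "AE \<xi> in lborel. Lambda_symbol \<alpha> \<beta> \<nu> t0 \<xi> * fourier (u t0) \<xi> = fourier f \<xi>"
proof -
  obtain U where U: "AE \<xi> in lborel. fourier (u t0) \<xi> = U \<xi> t0"
    and ode: "AE \<xi> in lborel. continuous_on {0..} (U \<xi>) \<and> U \<xi> 0 = 0 \<and>
      (\<forall>t>0. (U \<xi> has_vector_derivative (- z_symbol \<alpha> \<beta> \<nu> \<xi> * U \<xi> t + fourier f \<xi>)) (at t))"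
    using assms(2,3) unfolding solves_evolution_def by (meson less_imp_le)
  from U ode show ?thesis
  proof eventually_elim
    case (elim \<xi>)
    have "z_symbol \<alpha> \<beta> \<nu> \<xi> * U \<xi> t0 = (1 - exp (- z_symbol \<alpha> \<beta> \<nu> \<xi> * of_real t0)) * fourier f \<xi>"
      using elim assms(2) by (intro linear_ode_solution) auto
    moreover have "0 < norm (1 - exp (- z_symbol \<alpha> \<beta> \<nu> \<xi> * of_real t0))"
      by (rule less_le_trans[OF _ one_minus_exp_ge[OF assms(1,2)]]) (use assms(1,2) in simp)
    ultimately show ?case
      using elim by (simp add: Lambda_symbol_def)
  qed
qed

section \<open>Noise amplification and bias of the regularized inversion\<close>
lemma Lambda_symbol_measurable [measurable]: "Lambda_symbol \<alpha> \<beta> \<nu> t0 \<in> borel_measurable borel"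
  unfolding Lambda_symbol_def[abs_def] z_symbol_def[abs_def] by measurable

definition symbol_bound :: "real \<Rightarrow> real ^ 'n \<Rightarrow> real \<Rightarrow> real \<Rightarrow> real" where
  "symbol_bound \<alpha> \<beta> \<nu> t0 = (\<alpha>\<^sup>2 + norm \<beta> + \<nu>) / (1 - exp (- \<nu> * t0))"

text \<open>
  The symbol grows at most like \<open>1 + norm \<xi> ^ 2\<close>, and the filter has the same decay:
  \<open>1 + r\<^sup>2 \<le> (1 + 1 / m\<^sup>2) (1 + m\<^sup>2 r\<^sup>2)\<close>. The rate \<open>1 / m\<^sup>2\<close> at which the bound blows up
  decides how fast the parameter may tend to 0 with the noise level.
\<close>
lemma regularized_symbol_bound:
  assumes "0 < \<nu>" "0 < t0" "0 < m"
  shows "norm (Lambda_symbol \<alpha> \<beta> \<nu> t0 \<xi> / of_real (1 + m\<^sup>2 * (norm \<xi>)\<^sup>2))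
    \<le> symbol_bound \<alpha> \<beta> \<nu> t0 * (1 + 1 / m\<^sup>2)"
proof -
  let ?r = "norm \<xi>" and ?A = "\<alpha>\<^sup>2 + norm \<beta> + \<nu>" and ?q = "1 - exp (- \<nu> * t0)"
  have q: "0 < ?q" using assms by simp
  have A: "0 \<le> ?A" using assms by simp
  have "norm (z_symbol \<alpha> \<beta> \<nu> \<xi>) \<le> \<alpha>\<^sup>2 * ?r\<^sup>2 + \<bar>\<beta> \<bullet> \<xi>\<bar> + \<nu>"
    unfolding z_symbol_def using assms(1)
    by (intro order_trans[OF norm_triangle_ineq] add_mono) (auto simp: norm_mult simp flip: of_real_power of_real_mult)
  also have "\<dots> \<le> \<alpha>\<^sup>2 * (1 + ?r\<^sup>2) + norm \<beta> * (1 + ?r\<^sup>2) + \<nu> * (1 + ?r\<^sup>2)"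
    using assms(1) by (intro add_mono order_trans[OF Cauchy_Schwarz_ineq2] mult_left_mono le_one_plus_square) auto
  also have "\<dots> = ?A * (1 + ?r\<^sup>2)" by (simp add: algebra_simps)
  also have "\<dots> \<le> ?A * ((1 + 1 / m\<^sup>2) * (1 + m\<^sup>2 * ?r\<^sup>2))"
  proof (intro mult_left_mono A)
    have "(1 + 1 / m\<^sup>2) * (1 + m\<^sup>2 * ?r\<^sup>2) = 1 + ?r\<^sup>2 + (m\<^sup>2 * ?r\<^sup>2 + 1 / m\<^sup>2)"
      using assms(3) by (simp add: field_simps)
    then show "1 + ?r\<^sup>2 \<le> (1 + 1 / m\<^sup>2) * (1 + m\<^sup>2 * ?r\<^sup>2)" by simp
  qed
  finally have z: "norm (z_symbol \<alpha> \<beta> \<nu> \<xi>) \<le> ?A * ((1 + 1 / m\<^sup>2) * (1 + m\<^sup>2 * ?r\<^sup>2))" .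
  have D: "0 < 1 + m\<^sup>2 * ?r\<^sup>2" by (simp add: add_pos_nonneg)
  have "norm (Lambda_symbol \<alpha> \<beta> \<nu> t0 \<xi> / of_real (1 + m\<^sup>2 * ?r\<^sup>2))
      = norm (z_symbol \<alpha> \<beta> \<nu> \<xi>) / norm (1 - exp (- z_symbol \<alpha> \<beta> \<nu> \<xi> * of_real t0)) / (1 + m\<^sup>2 * ?r\<^sup>2)"
    using D unfolding Lambda_symbol_def norm_divide norm_of_real by simp
  also have "\<dots> \<le> ?A * ((1 + 1 / m\<^sup>2) * (1 + m\<^sup>2 * ?r\<^sup>2)) / ?q / (1 + m\<^sup>2 * ?r\<^sup>2)"
    using D q A by (intro divide_right_mono frac_le z one_minus_exp_ge assms) (auto intro!: mult_nonneg_nonneg)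
  also have "\<dots> = symbol_bound \<alpha> \<beta> \<nu> t0 * (1 + 1 / m\<^sup>2)"
    using D by (simp add: symbol_bound_def)
  finally show ?thesis .
qed

lemma R_op_bounded_linear:
  assumes "0 < \<nu>" "0 < t0" "0 < m"
  shows "bounded_linear_L2 (R_op \<alpha> \<beta> \<nu> t0 m)"
proof -
  define M where "M \<xi> = Lambda_symbol \<alpha> \<beta> \<nu> t0 \<xi> / of_real (1 + m\<^sup>2 * (norm \<xi>)\<^sup>2)" for \<xi>
  let ?C = "symbol_bound \<alpha> \<beta> \<nu> t0 * (1 + 1 / m\<^sup>2)"
  have M: "M \<in> borel_measurable borel" unfolding M_def[abs_def] by measurable
  note bd = regularized_symbol_bound[OF assms, of \<alpha> \<beta>, folded M_def]
  have C: "0 \<le> ?C" using bd[of 0] norm_ge_zero order_trans by blast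
  have R: "R_op \<alpha> \<beta> \<nu> t0 m g = (\<lambda>\<xi>. M \<xi> * g \<xi>)" for g
    by (simp add: R_op_def M_def fun_eq_iff)
  have "L2_norm (\<lambda>\<xi>. M \<xi> * g \<xi>) \<le> ?C * L2_norm g" if "g \<in> L2" for g
  proof (rule L2_norm_le)
    show "(\<lambda>\<xi>. M \<xi> * g \<xi>) \<in> borel_measurable borel"
      using L2_mult_bounded(1)[OF that M bd] by (simp add: L2_iff_sq_integral)
    show "sq_integral (\<lambda>\<xi>. M \<xi> * g \<xi>) \<le> ennreal ((?C * L2_norm g)\<^sup>2)"
      using L2_mult_bounded(2)[OF that M bd] sq_integral_eq_L2_norm[OF that]
      by (simp add: power_mult_distrib ennreal_mult)
    show "0 \<le> ?C * L2_norm g" by (rule mult_nonneg_nonneg[OF C]) (simp add: L2_norm_def)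
  qed
  then show ?thesis
    unfolding bounded_linear_L2_def R using L2_mult_bounded(1)[OF _ M bd]
    by (auto simp: algebra_simps intro!: exI[of _ ?C])
qed

lemma filter_defect_le_1: "\<bar>1 / (1 + m\<^sup>2 * r\<^sup>2) - 1\<bar> \<le> 1" for m r :: real
proof -
  have "0 \<le> 1 / (1 + m\<^sup>2 * r\<^sup>2)" "1 / (1 + m\<^sup>2 * r\<^sup>2) \<le> 1"
    by (auto simp: divide_le_eq_1 add_pos_nonneg)
  then show ?thesis by linarith
qed

text \<open>
  The factor \<open>1 / (1 + m\<^sup>2 (norm \<xi>)\<^sup>2) - 1\<close> tends to 0 pointwise and is bounded by 1, so
  dominated convergence applies with majorant \<open>(norm (h \<xi>))\<^sup>2\<close>. There is no rate, as
  \<open>h\<close> is an arbitrary element of \<open>L\<^sup>2\<close>.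
\<close>
lemma filter_bias_tendsto:
  fixes h :: "real ^ 'n \<Rightarrow> complex"
  assumes "h \<in> L2"
  shows "((\<lambda>m. sq_integral (\<lambda>\<xi>. of_real (1 / (1 + m\<^sup>2 * (norm \<xi>)\<^sup>2) - 1) * h \<xi>)) \<longlongrightarrow> 0) (at 0)"
  unfolding tendsto_at_iff_sequentially
proof (intro allI impI)
  fix X :: "nat \<Rightarrow> real" assume X: "X \<longlonglongrightarrow> 0"
  have [measurable]: "h \<in> borel_measurable borel" and fin: "sq_integral h < \<infinity>"
    using assms by (auto simp: L2_iff_sq_integral)
  let ?w = "\<lambda>m (\<xi>::real^'n). 1 / (1 + m\<^sup>2 * (norm \<xi>)\<^sup>2) - 1 :: real"
  have "(\<lambda>i. \<integral>\<^sup>+\<xi>. ennreal ((norm (of_real (?w (X i) \<xi>) * h \<xi>))\<^sup>2) \<partial>lborel)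
      \<longlonglongrightarrow> (\<integral>\<^sup>+\<xi>. 0 \<partial>(lborel :: (real^'n) measure))"
  proof (rule nn_integral_dominated_convergence)
    show "(\<integral>\<^sup>+\<xi>. ennreal ((norm (h \<xi>))\<^sup>2) \<partial>lborel) < \<infinity>" using fin by (simp add: sq_integral_def)
    show "AE \<xi> in lborel. ennreal ((norm (of_real (?w (X i) \<xi>) * h \<xi>))\<^sup>2) \<le> ennreal ((norm (h \<xi>))\<^sup>2)" for i
      unfolding norm_mult norm_of_real
      by (intro AE_I2 ennreal_leI power_mono mult_left_le_one_le filter_defect_le_1) auto
    show "AE \<xi> in lborel. (\<lambda>i. ennreal ((norm (of_real (?w (X i) \<xi>) * h \<xi>))\<^sup>2)) \<longlonglongrightarrow> 0"
    proof (rule AE_I2)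
      fix \<xi> :: "real^'n"
      have "(\<lambda>i. ennreal ((norm (of_real (?w (X i) \<xi>) * h \<xi>))\<^sup>2))
          \<longlonglongrightarrow> ennreal ((norm (of_real (?w 0 \<xi>) * h \<xi>))\<^sup>2)"
        using X by (intro tendsto_ennrealI tendsto_intros) auto
      then show "(\<lambda>i. ennreal ((norm (of_real (?w (X i) \<xi>) * h \<xi>))\<^sup>2)) \<longlonglongrightarrow> 0" by simp
    qed
  qed measurable
  then show "((\<lambda>m. sq_integral (\<lambda>\<xi>. of_real (?w m \<xi>) * h \<xi>)) \<circ> X) \<longlonglongrightarrow> 0"
    by (simp add: sq_integral_def comp_def)
qed

section \<open>Convergence of the regularization\<close>
theorem theorem1:
  fixes \<alpha> \<nu> t0 \<delta>M :: real
    and \<beta> :: "real ^ 'n"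
    and f :: "real ^ 'n \<Rightarrow> complex"
    and u :: "real \<Rightarrow> real ^ 'n \<Rightarrow> complex"
    and y :: "real ^ 'n \<Rightarrow> complex"
  assumes "\<alpha>\<^sup>2 > 0" and "\<nu> > 0" and "t0 > 0" and "\<delta>M > 0"
    and "f \<in> L2"
    and "solves_evolution \<alpha> \<beta> \<nu> f u"
    and "y = u t0"
  shows "\<exists>\<mu>. apriori_rule \<delta>M \<mu> \<and>
           convergent_regularization (Lambda_symbol \<alpha> \<beta> \<nu> t0) (R_op \<alpha> \<beta> \<nu> t0) \<mu> y"
proof -
  let ?L = "Lambda_symbol \<alpha> \<beta> \<nu> t0" and ?R = "R_op \<alpha> \<beta> \<nu> t0"
  define B where "B = symbol_bound \<alpha> \<beta> \<nu> t0"
  (* The noise is amplified by a factor of order 1 / \<mu>\<^sup>2, so the fourth root leaves a noise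
     contribution of order \<delta> / \<mu>\<^sup>2 = sqrt \<delta>. *)
  define \<mu> :: "real \<Rightarrow> real" where "\<mu> \<delta> = sqrt (sqrt \<delta>)" for \<delta>
  let ?w = "\<lambda>\<delta> \<xi>. of_real (1 / (1 + (\<mu> \<delta>)\<^sup>2 * (norm \<xi>)\<^sup>2) - 1) :: complex"
  let ?bias = "\<lambda>\<delta>. sq_integral (\<lambda>\<xi>. ?w \<delta> \<xi> * (?L \<xi> * fourier y \<xi>))"
  have y: "y \<in> L2"
    using assms(3,6,7) by (auto simp: solves_evolution_def)
  have Fm[measurable]: "fourier y \<in> borel_measurable borel"
    using fourier_L2_limit(1)[OF y] by (simp add: L2_iff_sq_integral)
  have "sq_integral (\<lambda>\<xi>. ?L \<xi> * fourier y \<xi>) = sq_integral (fourier f)"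
    using fourier_source_eq[OF assms(2,3,6)] assms(7) by (intro sq_integral_cong_AE) auto
  then have Ly: "(\<lambda>\<xi>. ?L \<xi> * fourier y \<xi>) \<in> L2"
    using fourier_L2_limit(1)[OF assms(5)] by (auto simp: L2_iff_sq_integral)
  have \<mu>_pos: "0 < \<mu> \<delta>" if "0 < \<delta>" for \<delta> using that by (simp add: \<mu>_def)
  have "(\<mu> \<longlongrightarrow> sqrt (sqrt 0)) (at_right 0)"
    unfolding \<mu>_def by (intro tendsto_intros)
  then have \<mu>_lim: "(\<mu> \<longlongrightarrow> 0) (at_right 0)" by simp
  have "\<forall>\<^sub>F \<delta> in at_right 0. \<mu> \<delta> \<noteq> 0"
    using eventually_at_right_less[of "0::real"] by eventually_elim (use \<mu>_pos in force)
  then have "filterlim \<mu> (at 0) (at_right 0)"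
    unfolding filterlim_at using \<mu>_lim by simp
  from filterlim_compose[OF filter_bias_tendsto[OF Ly] this]
  have bias_lim: "(?bias \<longlongrightarrow> 0) (at_right 0)" .
  (* The bound on all errors at noise level \<delta>; its square is twice the bound
     4 (B (\<delta> + sqrt \<delta>))\<^sup>2 on the propagated noise plus twice the squared bias. *)
  define \<rho> where "\<rho> \<delta> = sqrt (8 * (B * (\<delta> + sqrt \<delta>))\<^sup>2 + 2 * enn2real (?bias \<delta>))" for \<delta>
  have "(\<rho> \<longlongrightarrow> sqrt (8 * (B * (0 + sqrt 0))\<^sup>2 + 2 * 0)) (at_right 0)"
    unfolding \<rho>_def by (intro tendsto_intros tendsto_enn2real) (use bias_lim in auto)
  then have \<rho>_lim: "((\<lambda>\<delta>. ennreal (\<rho> \<delta>)) \<longlongrightarrow> 0) (at_right 0)"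
    using tendsto_ennrealI by fastforce
  have error: "L2_norm (\<lambda>\<xi>. ?R (\<mu> \<delta>) (fourier y\<delta>) \<xi> - ?L \<xi> * fourier y \<xi>) \<le> \<rho> \<delta>"
    if \<delta>: "0 < \<delta>" and y\<delta>: "y\<delta> \<in> L2" "L2_norm (\<lambda>x. y\<delta> x - y x) \<le> \<delta>" for \<delta> y\<delta>
  proof (rule L2_norm_le)
    let ?M = "\<lambda>\<xi>. ?L \<xi> / of_real (1 + (\<mu> \<delta>)\<^sup>2 * (norm \<xi>)\<^sup>2)"
    let ?C = "B * (1 + 1 / (\<mu> \<delta>)\<^sup>2)"
    let ?D = "\<lambda>\<xi>. fourier y\<delta> \<xi> - fourier y \<xi>"
    have [measurable]: "fourier y\<delta> \<in> borel_measurable borel"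
      using fourier_L2_limit(1)[OF y\<delta>(1)] by (simp add: L2_iff_sq_integral)
    have split: "?R (\<mu> \<delta>) (fourier y\<delta>) \<xi> - ?L \<xi> * fourier y \<xi>
        = ?M \<xi> * ?D \<xi> + ?w \<delta> \<xi> * (?L \<xi> * fourier y \<xi>)" for \<xi>
      by (simp add: R_op_def algebra_simps diff_divide_distrib)
    show "(\<lambda>\<xi>. ?R (\<mu> \<delta>) (fourier y\<delta>) \<xi> - ?L \<xi> * fourier y \<xi>) \<in> borel_measurable borel"
      unfolding split by measurable
    have "sq_integral (\<lambda>x. y\<delta> x - y x) \<le> ennreal (\<delta>\<^sup>2)"
      unfolding sq_integral_eq_L2_norm[OF L2_diff[OF y\<delta>(1) y]]
      using y\<delta>(2) by (intro ennreal_leI power_mono) (auto simp: L2_norm_def)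
    then have "4 * sq_integral (\<lambda>x. y\<delta> x - y x) \<le> ennreal (4 * \<delta>\<^sup>2)"
      by (simp add: ennreal_mult' mult_left_mono)
    with fourier_Lipschitz[OF y\<delta>(1) y] have D: "sq_integral ?D \<le> ennreal (4 * \<delta>\<^sup>2)"
      by (rule order_trans)
    have "sq_integral (\<lambda>\<xi>. ?M \<xi> * ?D \<xi>) \<le> ennreal (?C\<^sup>2) * sq_integral ?D"
      unfolding B_def
      by (intro L2_mult_bounded(2) L2_diff fourier_L2_limit(1) y y\<delta> regularized_symbol_bound assms(2,3) \<mu>_pos \<delta>) measurable
    also have "\<dots> \<le> ennreal (?C\<^sup>2) * ennreal (4 * \<delta>\<^sup>2)"
      by (intro mult_left_mono D) simp
    also have "\<dots> = ennreal (4 * (?C * \<delta>)\<^sup>2)"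
      by (simp add: ennreal_mult'[symmetric] power_mult_distrib ac_simps)
    also have "?C * \<delta> = B * (\<delta> + sqrt \<delta>)"
    proof -
      have "(1 + 1 / (\<mu> \<delta>)\<^sup>2) * \<delta> = \<delta> + sqrt \<delta>"
        using \<delta> real_div_sqrt[of \<delta>] by (simp add: \<mu>_def distrib_right)
      then show ?thesis by (simp only: mult.assoc)
    qed
    finally have noise: "sq_integral (\<lambda>\<xi>. ?M \<xi> * ?D \<xi>) \<le> ennreal (4 * (B * (\<delta> + sqrt \<delta>))\<^sup>2)" .
    have "?bias \<delta> \<le> ennreal (1\<^sup>2) * sq_integral (\<lambda>\<xi>. ?L \<xi> * fourier y \<xi>)"
      by (intro L2_mult_bounded(2) Ly) (measurable, simp only: norm_of_real filter_defect_le_1)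
    then have fin: "?bias \<delta> < \<infinity>"
      using Ly by (auto simp: L2_iff_sq_integral intro: order.strict_trans1)
    have "sq_integral (\<lambda>\<xi>. ?R (\<mu> \<delta>) (fourier y\<delta>) \<xi> - ?L \<xi> * fourier y \<xi>)
        \<le> 2 * sq_integral (\<lambda>\<xi>. ?M \<xi> * ?D \<xi>) + 2 * ?bias \<delta>"
      unfolding split by (rule sq_integral_add_le) measurable
    also have "\<dots> \<le> 2 * ennreal (4 * (B * (\<delta> + sqrt \<delta>))\<^sup>2) + 2 * ennreal (enn2real (?bias \<delta>))"
      using noise fin by (intro add_mono mult_left_mono) auto
    also have "\<dots> = ennreal ((\<rho> \<delta>)\<^sup>2)"
      by (simp add: \<rho>_def ennreal_mult')
    finally show "sq_integral (\<lambda>\<xi>. ?R (\<mu> \<delta>) (fourier y\<delta>) \<xi> - ?L \<xi> * fourier y \<xi>)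
        \<le> ennreal ((\<rho> \<delta>)\<^sup>2)" .
    show "0 \<le> \<rho> \<delta>" by (simp add: \<rho>_def)
  qed
  have "((\<lambda>\<delta>. SUP y\<delta> \<in> {y\<delta> \<in> L2. L2_norm (\<lambda>x. y\<delta> x - y x) \<le> \<delta>}.
      ennreal (L2_norm (\<lambda>\<xi>. ?R (\<mu> \<delta>) (fourier y\<delta>) \<xi> - ?L \<xi> * fourier y \<xi>))) \<longlongrightarrow> 0) (at_right 0)"
  proof (rule tendsto_sandwich[OF _ _ tendsto_const \<rho>_lim])
    show "\<forall>\<^sub>F \<delta> in at_right 0. (SUP y\<delta> \<in> {y\<delta> \<in> L2. L2_norm (\<lambda>x. y\<delta> x - y x) \<le> \<delta>}.
      ennreal (L2_norm (\<lambda>\<xi>. ?R (\<mu> \<delta>) (fourier y\<delta>) \<xi> - ?L \<xi> * fourier y \<xi>))) \<le> ennreal (\<rho> \<delta>)"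
      using eventually_at_right_less[of "0::real"]
      by eventually_elim (auto intro!: SUP_least ennreal_leI error)
  qed simp
  moreover have "apriori_rule \<delta>M \<mu>"
    by (simp add: apriori_rule_def \<mu>_pos)
  ultimately show ?thesis
    unfolding convergent_regularization_def
    using Ly y \<mu>_lim R_op_bounded_linear[OF assms(2,3)] by blast
qed

end
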